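(* Let $\Omega$ be a subdomain of $\mathbb C$ and let $n\ge1$ be an integer. For $w\in\Omega$ write $d_w=\mathrm{dist}(w,\partial\Omega)$. Let $z\in\Omega$, and assume that $a_z\in\partial\Omega$ is such that $|z-a_z|=d_z$, and that $\zeta\in\Omega$ is such that $[\zeta,a_z]$ is the maximal interval (line segment ending at $a_z$) containing $z$ with $d_\zeta=|\zeta-a_z|$. Let $f$ be holomorphic in $\Omega$ with $\Re f\in L^\infty(\Omega)$ and $\|\Re f\|_{L^\infty(\Omega)}\le1$. Then $$d_z^{\,n}\,|f^{(n)}(z)|\le\frac{C_n}{(2-d_z/d_\zeta)^n},$$ where $$C_n=C_{\infty,n}=\frac{n!}{\pi}\,2^{n}\max_{0\le\beta\le\pi/2}\int_0^{\pi}\left|\sin^{n-1}(v)\cos\!\left[v(n+1)+\beta-\tfrac{\pi}{2}(n-1)\right]\right|dv .$$ In particular, if $n=2m-1$ with $m\ge1$ an integer, then $$d_z^{\,2m-1}\,|f^{(2m-1)}(z)|\le\frac{1}{n\pi}\,\frac{((2m)!)^2}{(m!)^2}\,\frac{1}{(2-d_z/d_\zeta)^{n}} .$$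
   Context: $[\zeta,a_z]$ denotes the closed straight line segment with endpoints $\zeta$ and $a_z$. "Maximal" means that among all segments $[\zeta',a_z]$ with $\zeta'\in\Omega$, $z\in[\zeta',a_z]$ and $d_{\zeta'}=|\zeta'-a_z|$, the segment $[\zeta,a_z]$ is the largest; the existence of such a $\zeta$ is part of the hypothesis. *)

theory Defs
  imports
    "HOL-Complex_Analysis.Complex_Analysis"
    "HOL-Probability.Essential_Supremum"
begin

definition bdist :: "complex set \<Rightarrow> complex \<Rightarrow> real" where
  "bdist \<Omega> w = infdist w (frontier \<Omega>)"

(* By the convention of esssup the value is \<infinity> if g is not measurable, so
   finiteness of this norm is membership in the space of essentially bounded functions. *)
definition linf_norm :: "complex set \<Rightarrow> (complex \<Rightarrow> real) \<Rightarrow> ereal" where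
  "linf_norm \<Omega> g = esssup (lebesgue_on \<Omega>) (\<lambda>w. ereal \<bar>g w\<bar>)"

definition contact_point :: "complex set \<Rightarrow> complex \<Rightarrow> complex \<Rightarrow> complex \<Rightarrow> bool" where
  "contact_point \<Omega> a z \<zeta> \<longleftrightarrow>
     \<zeta> \<in> \<Omega> \<and> z \<in> closed_segment \<zeta> a \<and> bdist \<Omega> \<zeta> = cmod (\<zeta> - a)"

definition maximal_contact_point :: "complex set \<Rightarrow> complex \<Rightarrow> complex \<Rightarrow> complex \<Rightarrow> bool" where
  "maximal_contact_point \<Omega> a z \<zeta> \<longleftrightarrow>
     contact_point \<Omega> a z \<zeta> \<and>
     (\<forall>\<zeta>'. contact_point \<Omega> a z \<zeta>' \<longrightarrow> closed_segment \<zeta>' a \<subseteq> closed_segment \<zeta> a)"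

definition sin_cos_integral :: "nat \<Rightarrow> real \<Rightarrow> real" where
  "sin_cos_integral n \<beta> =
     integral {0..pi}
       (\<lambda>v. \<bar>sin v ^ (n - 1) * cos (v * (real n + 1) + \<beta> - pi / 2 * (real n - 1))\<bar>)"

(* The supremum is a maximum: see sin_cos_integral_attains_SUP below. *)
definition C_inf :: "nat \<Rightarrow> real" where
  "C_inf n = fact n / pi * 2 ^ n * (SUP \<beta>\<in>{0..pi/2}. sin_cos_integral n \<beta>)"

lemma continuous_on_sin_cos_integral: "continuous_on A (sin_cos_integral n)"
proof -
  have "continuous_on A (\<lambda>\<beta>. integral (cbox 0 pi)
       (\<lambda>v. \<bar>sin v ^ (n - 1) * cos (v * (real n + 1) + \<beta> - pi / 2 * (real n - 1))\<bar>))"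
    by (rule integral_continuous_on_param)
       (auto simp: case_prod_unfold intro!: continuous_intros)
  then show ?thesis
    by (simp add: sin_cos_integral_def[abs_def])
qed

lemma sin_cos_integral_attains_SUP:
  obtains \<beta>0 where "\<beta>0 \<in> {0..pi/2}"
    and "sin_cos_integral n \<beta>0 = (SUP \<beta>\<in>{0..pi/2}. sin_cos_integral n \<beta>)"
    and "\<And>\<beta>. \<beta> \<in> {0..pi/2} \<Longrightarrow> sin_cos_integral n \<beta> \<le> sin_cos_integral n \<beta>0"
proof -
  obtain \<beta>0 where b: "\<beta>0 \<in> {0..pi/2}"
      "\<And>\<beta>. \<beta> \<in> {0..pi/2} \<Longrightarrow> sin_cos_integral n \<beta> \<le> sin_cos_integral n \<beta>0"
    using continuous_attains_sup[of "{0..pi/2}" "sin_cos_integral n"]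
      continuous_on_sin_cos_integral by auto
  then have "(SUP \<beta>\<in>{0..pi/2}. sin_cos_integral n \<beta>) = sin_cos_integral n \<beta>0"
    by (intro cSup_eq_maximum) auto
  with b show ?thesis by (intro that) auto
qed

end

theory Submission
  imports Defs
begin

text \<open>The disc about \<open>\<zeta>\<close> of radius \<open>R = d\<^sub>\<zeta>\<close> lies in the domain, so it suffices to bound the
  derivatives in the unit disc. There a Moebius change of variables expresses
  \<open>(1 - |z|\<^sup>2)\<^sup>n f\<^sup>(\<^sup>n\<^sup>)(z) / n!\<close> as the polynomial \<open>\<Sum>k<n. (n - 1 choose k) s\<^sup>k g\<^sub>n\<^sub>-\<^sub>k\<close> at
  \<open>s = cnj z\<close>, with \<open>g\<^sub>j\<close> the Taylor coefficients of the transported function. By the maximum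
  principle in \<open>s\<close> and a rotation, the worst case is \<open>s = -1\<close>; there the polynomial is the integral
  of the boundary values of the real part against a kernel whose modulus is the sine-cosine
  integrand. For odd \<open>n\<close> the factor \<open>|cos (v (n + 1) + \<beta>)|\<close> has period \<open>\<pi> / (n + 1)\<close>, while
  \<open>sin\<^sup>n\<^sup>-\<^sup>1\<close> has only lower frequencies, so the integral does not depend on \<open>\<beta>\<close>.\<close>

section \<open>Moments of the real part on circles\<close>

text \<open>The constant \<open>pi / 2\<close> is Cauchy's \<open>2 * pi\<close>, halved by passing
  from \<open>g\<close> to its real part and halved again by the substitution
  \<open>t = 2 * v\<close>. That substitution makes the range \<open>{0..pi}\<close>, as in
  \<open>sin_cos_integral\<close>.\<close>

lemma circle_moment:
  fixes g :: "complex \<Rightarrow> complex"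
  assumes g: "g holomorphic_on ball 0 1" and \<rho>: "0 < \<rho>" "\<rho> < 1" and j: "j \<ge> 1"
  shows "((\<lambda>v. of_real (Re (g (\<rho> * cis (2 * v)))) * cis (- (2 * real j * v)))
      has_integral pi / 2 * \<rho> ^ j * ((deriv ^^ j) g 0 / fact j)) {0..pi}"
proof -
  define I where "I = 2 * pi * \<rho> ^ j * ((deriv ^^ j) g 0 / fact j)"
  have sub: "cball 0 \<rho> \<subseteq> (ball 0 1 :: complex set)" using \<rho> by auto
  have cont: "continuous_on (cball 0 \<rho>) g"
    using holomorphic_on_imp_continuous_on[OF g] continuous_on_subset sub by blast
  have hol: "g holomorphic_on ball 0 \<rho>"
    using g by (rule holomorphic_on_subset) (use \<rho> in auto)
  have "((\<lambda>u. g u / (u - 0) ^ Suc j) has_contour_integral 2 * pi * \<i> / fact j * (deriv ^^ j) g 0)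
      (circlepath 0 \<rho>)"
    by (rule Cauchy_has_contour_integral_higher_derivative_circlepath[OF cont hol]) (use \<rho> in auto)
  then have "((\<lambda>t. g (\<rho> * cis t) / (\<rho> * cis t) ^ Suc j * \<rho> * \<i> * cis t)
      has_integral 2 * pi * \<i> / fact j * (deriv ^^ j) g 0) {0..2 * pi}"
    by (simp add: circlepath_def has_contour_integral_part_circlepath_iff)
  \<comment> \<open>This factor cancels \<open>\<rho>\<close> and \<open>\<i>\<close>, which turns
    Cauchy's formula into a Fourier moment.\<close>
  from has_integral_mult_right[OF this, of "\<rho> ^ j / \<i>"]
  have "((\<lambda>t. \<rho> ^ j / \<i> * (g (\<rho> * cis t) / (\<rho> * cis t) ^ Suc j * \<rho> * \<i> * cis t)) has_integral I) {0..2 * pi}"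
    by (simp add: I_def mult_ac)
  moreover have "\<rho> ^ j / \<i> * (g (\<rho> * cis t) / (\<rho> * cis t) ^ Suc j * \<rho> * \<i> * cis t)
      = g (\<rho> * cis t) * cis (- (real j * t))" for t
  proof -
    have "\<rho> ^ j / \<i> * (g (\<rho> * cis t) / (\<rho> * cis t) ^ Suc j * \<rho> * \<i> * cis t)
        = g (\<rho> * cis t) * inverse (cis t ^ j)"
      using \<rho> by (simp add: power_mult_distrib field_simps)
    then show ?thesis by (simp add: Complex.DeMoivre cis_inverse)
  qed
  ultimately have 1: "((\<lambda>t. g (\<rho> * cis t) * cis (- (real j * t))) has_integral I) {0..2 * pi}"
    by simp
  \<comment> \<open>As \<open>j \<ge> 1\<close>, this integrand has no pole, so the moment of
    opposite frequency vanishes.\<close>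
  have "((\<lambda>u. g u * u ^ (j - 1)) has_contour_integral 0) (circlepath 0 \<rho>)"
    by (rule Cauchy_theorem_disc_simple[of _ 0 1])
       (use \<rho> g in \<open>auto intro!: holomorphic_intros\<close>)
  then have "((\<lambda>t. g (\<rho> * cis t) * (\<rho> * cis t) ^ (j - 1) * \<rho> * \<i> * cis t) has_integral 0) {0..2 * pi}"
    by (simp add: circlepath_def has_contour_integral_part_circlepath_iff)
  from has_integral_mult_right[OF this, of "1 / (\<rho> ^ j * \<i>)"]
  have "((\<lambda>t. 1 / (\<rho> ^ j * \<i>) * (g (\<rho> * cis t) * (\<rho> * cis t) ^ (j - 1) * \<rho> * \<i> * cis t)) has_integral 0) {0..2 * pi}"
    by simp
  moreover have "1 / (\<rho> ^ j * \<i>) * (g (\<rho> * cis t) * (\<rho> * cis t) ^ (j - 1) * \<rho> * \<i> * cis t)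
      = g (\<rho> * cis t) * cis (real j * t)" for t
  proof -
    have pow: "(\<rho> * cis t) ^ (j - 1) * (\<rho> * cis t) = \<rho> ^ j * cis (real j * t)"
      using j by (simp only: power_Suc2[symmetric]) (simp add: power_mult_distrib Complex.DeMoivre)
    have "1 / (\<rho> ^ j * \<i>) * (g (\<rho> * cis t) * (\<rho> * cis t) ^ (j - 1) * \<rho> * \<i> * cis t)
        = 1 / (\<rho> ^ j * \<i>) * (g (\<rho> * cis t) * \<i> * ((\<rho> * cis t) ^ (j - 1) * (\<rho> * cis t)))"
      by (simp only: mult_ac)
    also have "\<dots> = 1 / (\<rho> ^ j * \<i>) * (g (\<rho> * cis t) * \<i> * (\<rho> ^ j * cis (real j * t)))"
      by (simp only: pow)
    also have "\<dots> = g (\<rho> * cis t) * cis (real j * t)"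
      using \<rho> by simp
    finally show ?thesis .
  qed
  ultimately have "((\<lambda>t. g (\<rho> * cis t) * cis (real j * t)) has_integral 0) {0..2 * pi}"
    by simp
  \<comment> \<open>The conjugate has no moment of positive order, which lets us pass to the real part.\<close>
  from has_integral_linear[OF this bounded_linear_cnj]
  have 2: "((\<lambda>t. cnj (g (\<rho> * cis t)) * cis (- (real j * t))) has_integral 0) {0..2 * pi}"
    by (simp add: o_def cis_cnj)
  have half: "of_real (Re w) * c = (w * c + cnj w * c) / 2" for w c :: complex
    by (simp add: complex_add_cnj flip: distrib_right)
  have "((\<lambda>t. of_real (Re (g (\<rho> * cis t))) * cis (- (real j * t))) has_integral I / 2) {0..2 * pi}"
    using has_integral_divide[OF has_integral_add[OF 1 2], of 2] by (simp only: half add_0_right)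
  from has_integral_affinity'[of _ _ 0 "2 * pi" 2 0, OF this[folded cbox_interval]]
  show ?thesis
    by (simp add: I_def mult_ac scaleR_conv_of_real)
qed

section \<open>Symmetries of the sine-cosine integral in its phase\<close>

lemma sin_cos_integral_has_integral:
  "((\<lambda>v. \<bar>sin v ^ (n - 1) * cos (v * (real n + 1) + \<beta> - pi / 2 * (real n - 1))\<bar>)
    has_integral sin_cos_integral n \<beta>) {0..pi}"
  unfolding sin_cos_integral_def
  by (intro integrable_integral integrable_continuous_real continuous_intros)

text \<open>The reflection of \<open>v\<close> to \<open>pi - v\<close> fixes the sine and sends the
  argument \<open>x\<close> of the cosine, up to the sign of the phase, to
  \<open>2 * pi - x\<close>.\<close>

lemma sin_cos_integral_minus: "sin_cos_integral n (- \<beta>) = sin_cos_integral n \<beta>"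
proof -
  have "((\<lambda>v. \<bar>sin (pi - v) ^ (n - 1) *
      cos ((pi - v) * (real n + 1) + - \<beta> - pi / 2 * (real n - 1))\<bar>)
      has_integral sin_cos_integral n (- \<beta>)) {0..pi}"
    using has_integral_affinity[of _ _ 0 pi "-1" pi,
        OF sin_cos_integral_has_integral[of n "- \<beta>", folded cbox_interval]]
    by (simp add: add.commute)
  moreover have "(pi - v) * (real n + 1) + - \<beta> - pi / 2 * (real n - 1)
      = 2 * pi - (v * (real n + 1) + \<beta> - pi / 2 * (real n - 1))" for v
    by (simp add: field_simps)
  ultimately have "((\<lambda>v. \<bar>sin v ^ (n - 1) * cos (v * (real n + 1) + \<beta> - pi / 2 * (real n - 1))\<bar>)
      has_integral sin_cos_integral n (- \<beta>)) {0..pi}"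
    by (simp only: sin_pi_minus) (simp only: cos_diff cos_two_pi sin_two_pi, simp)
  then show ?thesis
    using sin_cos_integral_has_integral has_integral_unique by blast
qed

lemma abs_cos_add_int_pi: "\<bar>cos (x + of_int k * pi)\<bar> = \<bar>cos x\<bar>"
proof -
  have "sin (of_int k * pi) = 0"
    by (auto simp: sin_zero_iff_int2)
  then have "\<bar>cos (of_int k * pi)\<bar> = 1"
    using sin_cos_squared_add[of "of_int k * pi"] by (auto simp: power2_eq_1_iff)
  with \<open>sin (of_int k * pi) = 0\<close> show ?thesis
    by (simp add: cos_add abs_mult)
qed

lemma sin_cos_integral_add_int_pi: "sin_cos_integral n (\<beta> + of_int k * pi) = sin_cos_integral n \<beta>"
proof -
  have "\<bar>cos (v * (real n + 1) + (\<beta> + of_int k * pi) - pi / 2 * (real n - 1))\<bar>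
      = \<bar>cos (v * (real n + 1) + \<beta> - pi / 2 * (real n - 1))\<bar>" for v
    using abs_cos_add_int_pi[of "v * (real n + 1) + \<beta> - pi / 2 * (real n - 1)" k]
    by (simp add: algebra_simps)
  then show ?thesis
    unfolding sin_cos_integral_def abs_mult by simp
qed

text \<open>Being even and \<open>pi\<close>-periodic in the phase, the integral takes all its
  values on \<open>{0..pi/2}\<close>. This admits the arbitrary phase that arises below from an
  argument of a complex number.\<close>

lemma sin_cos_integral_le_SUP:
  "sin_cos_integral n \<beta> \<le> (SUP \<beta>\<in>{0..pi/2}. sin_cos_integral n \<beta>)"
proof -
  \<comment> \<open>\<open>k\<close> is an integer nearest to \<open>\<beta> / pi\<close>.\<close>
  define k where "k = \<lfloor>\<beta> / pi + 1 / 2\<rfloor>"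
  define \<gamma> where "\<gamma> = \<beta> + of_int (- k) * pi"
  have "of_int k \<le> \<beta> / pi + 1 / 2" "\<beta> / pi + 1 / 2 \<le> of_int k + 1"
    unfolding k_def by linarith+
  then have "\<bar>\<gamma>\<bar> \<le> pi / 2"
    unfolding \<gamma>_def abs_le_iff by (simp add: field_simps)
  moreover have "sin_cos_integral n \<beta> = sin_cos_integral n \<bar>\<gamma>\<bar>"
    using sin_cos_integral_add_int_pi[of n \<beta> "- k"] sin_cos_integral_minus[of n \<gamma>]
    by (auto simp: \<gamma>_def abs_if)
  ultimately show ?thesis
    by (metis sin_cos_integral_attains_SUP abs_ge_zero atLeastAtMost_iff)
qed

section \<open>Taylor coefficients under a Moebius change of variables\<close>

text \<open>Without a constant term in \<open>F\<close>, the series \<open>F ^ k\<close> starts at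
  degree \<open>k\<close>. Hence one cutoff \<open>k \<le> n\<close> serves all coefficients up to
  \<open>n\<close>, and the two finite sums can be exchanged.\<close>

lemma fps_nth_mult_compose:
  fixes F G H :: "'a::comm_ring_1 fps"
  assumes "fps_nth F 0 = 0"
  shows "fps_nth (G * (H oo F)) n = (\<Sum>k\<le>n. fps_nth H k * fps_nth (G * F ^ k) n)"
proof -
  have ext: "fps_nth (H oo F) (n - i) = (\<Sum>k\<le>n. fps_nth H k * fps_nth (F ^ k) (n - i))" for i
    unfolding fps_compose_nth atMost_atLeast0
    by (rule sum.mono_neutral_left) (auto simp: startsby_zero_power_prefix[OF assms])
  show ?thesis
    unfolding fps_mult_nth atMost_atLeast0[symmetric] ext
    by (subst sum_distrib_left, subst sum.swap) (simp add: sum_distrib_left mult_ac)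
qed

lemma fps_nth_linear_power:
  fixes c :: "'a::comm_ring_1"
  shows "fps_nth ((1 + fps_const c * fps_X) ^ m) i = of_nat (m choose i) * c ^ i"
proof -
  have "(1 + fps_const c * fps_X) ^ m = (\<Sum>k\<le>m. fps_const (of_nat (m choose k) * c ^ k) * fps_X ^ k)"
    by (subst add.commute, subst binomial_ring)
       (simp add: power_mult_distrib fps_of_nat[symmetric] mult.assoc fps_const_power flip: fps_const_mult)
  then have "fps_nth ((1 + fps_const c * fps_X) ^ m) i
      = (\<Sum>k\<le>m. if i = k then of_nat (m choose k) * c ^ k else 0)"
    by (simp add: fps_sum_nth if_distrib cong: if_cong)
  then show ?thesis
    by (simp add: binomial_eq_0)
qed

text \<open>Both sides are the \<open>n\<close>-th coefficient of
  \<open>(1 + cnj z * w) ^ (n - 1) * g w\<close> at 0. The right side expands the power binomially.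
  The left side expands \<open>h\<close> about \<open>z\<close>, where the Moebius map is
  \<open>z + c * w / (1 + cnj z * w)\<close>: only the \<open>n\<close>-th Taylor term of
  \<open>h\<close> survives.\<close>

lemma taylor_coeff_moebius:
  fixes h :: "complex \<Rightarrow> complex"
  assumes h: "h holomorphic_on ball 0 1" and z: "cmod z < 1" and n: "n \<ge> 1"
  defines "g \<equiv> \<lambda>w. h ((w + z) / (1 + cnj z * w))"
  shows "(deriv ^^ n) h z / fact n * of_real (1 - (cmod z)\<^sup>2) ^ n =
    (\<Sum>k<n. of_nat (n - 1 choose k) * cnj z ^ k * ((deriv ^^ (n - k)) g 0 / fact (n - k)))"
proof -
  define c where "c = complex_of_real (1 - (cmod z)\<^sup>2)"
  define A where "A = 1 + fps_const (cnj z) * fps_X"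
  define F where "F = fps_const c * fps_X * inverse A"
  define H where "H = fps_expansion h z"
  have A0: "fps_nth A 0 = 1" by (simp add: A_def)
  have invA: "A * inverse A = 1"
    using A0 by (simp add: inverse_mult_eq_1' )
  have H: "(\<lambda>x. h (z + x)) has_fps_expansion H"
    unfolding H_def by (rule analytic_at_imp_has_fps_expansion)
      (use h z in \<open>auto simp: analytic_at intro!: exI[of _ "ball 0 1"]\<close>)
  have F: "(\<lambda>w. c * w * inverse (1 + cnj z * w)) has_fps_expansion F"
    unfolding F_def A_def by (intro fps_expansion_intros) auto
  have F0: "fps_nth F 0 = 0" by (simp add: F_def)
  have "((\<lambda>x. h (z + x)) \<circ> (\<lambda>w. c * w * inverse (1 + cnj z * w))) has_fps_expansion (H oo F)"
    by (rule has_fps_expansion_compose[OF H F F0])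
  moreover have "eventually (\<lambda>w. 1 + cnj z * w \<noteq> 0) (nhds 0)"
    by (rule tendsto_imp_eventually_ne[where c = "1 + cnj z * 0"])
       (auto intro!: tendsto_eq_intros filterlim_ident)
  then have "eventually (\<lambda>w. ((\<lambda>x. h (z + x)) \<circ> (\<lambda>w. c * w * inverse (1 + cnj z * w))) w = g w) (nhds 0)"
  proof eventually_elim
    case (elim w)
    have "z + c * w * inverse (1 + cnj z * w) = (w + z) / (1 + cnj z * w)"
      using elim complex_norm_square[of z] by (simp add: c_def field_simps)
    then show ?case by (simp add: g_def)
  qed
  ultimately have g: "g has_fps_expansion (H oo F)"
    using has_fps_expansion_cong by metis
  have pw: "A ^ (n - 1) * F ^ k = fps_const (c ^ k) * fps_X ^ k * A ^ (n - 1 - k)" if "k < n" for k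
  proof -
    have "A ^ (n - 1) = A ^ (n - 1 - k) * A ^ k"
      using that by (simp flip: power_add)
    then have "A ^ (n - 1) * F ^ k = fps_const (c ^ k) * fps_X ^ k * A ^ (n - 1 - k) * (A * inverse A) ^ k"
      by (simp add: F_def power_mult_distrib mult_ac fps_const_power)
    then show ?thesis by (simp add: invA)
  qed
  \<comment> \<open>One more factor \<open>inverse A\<close> is present than
    \<open>A ^ (n - 1)\<close> can cancel. It has constant term 1, so the coefficient at degree
    \<open>n\<close> is still \<open>c ^ n\<close>.\<close>
  have pwn: "A ^ (n - 1) * F ^ n = fps_const (c ^ n) * fps_X ^ n * inverse A"
  proof -
    have "F ^ n = F ^ (n - 1) * F"
      using n by (simp flip: power_Suc2)
    then have "A ^ (n - 1) * F ^ n = (A ^ (n - 1) * F ^ (n - 1)) * F"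
      by (simp add: mult_ac)
    also have "\<dots> = fps_const (c ^ (n - 1)) * fps_X ^ (n - 1) * (fps_const c * fps_X * inverse A)"
      using n by (subst pw) (auto simp: F_def)
    also have "\<dots> = fps_const (c ^ (n - 1) * c) * (fps_X ^ (n - 1) * fps_X) * inverse A"
      by (simp add: mult_ac flip: fps_const_mult)
    also have "\<dots> = fps_const (c ^ n) * fps_X ^ n * inverse A"
      using n by (simp flip: power_Suc2)
    finally show ?thesis .
  qed
  \<comment> \<open>The first \<open>n\<close> Taylor terms of \<open>h\<close> at \<open>z\<close> become polynomials of degree at most \<open>n - 1\<close>.\<close>
  have lower: "fps_nth (A ^ (n - 1) * F ^ k) n = 0" if "k < n" for k
    using that n by (subst pw)
      (auto simp: mult.assoc fps_X_power_mult_nth A_def fps_nth_linear_power binomial_eq_0)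
  have "fps_nth (A ^ (n - 1) * (H oo F)) n = fps_nth H n * c ^ n"
    unfolding fps_nth_mult_compose[OF F0]
    by (subst sum.remove[of _ n])
       (auto simp: lower pwn mult.assoc fps_X_power_mult_nth A0 simp del: One_nat_def)
  moreover have "fps_nth (A ^ (n - 1) * (H oo F)) n
      = (\<Sum>k\<le>n. of_nat (n - 1 choose k) * cnj z ^ k * ((deriv ^^ (n - k)) g 0 / fact (n - k)))"
    unfolding fps_mult_nth atMost_atLeast0[symmetric] A_def fps_nth_linear_power
      fps_nth_fps_expansion[OF g] ..
  \<comment> \<open>The term \<open>k = n\<close> carries \<open>n - 1 choose n\<close>, which is 0.
    So \<open>g 0\<close>, over whose imaginary part there is no control, drops out.\<close>
  moreover have "\<dots> = (\<Sum>k<n. of_nat (n - 1 choose k) * cnj z ^ k * ((deriv ^^ (n - k)) g 0 / fact (n - k)))"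
    using n by (intro sum.mono_neutral_right) (auto simp: binomial_eq_0)
  ultimately show ?thesis
    by (simp add: H_def fps_expansion_def c_def)
qed

section \<open>The sharp bound in the unit disc\<close>

text \<open>The half-angle identity \<open>1 - cis (2 * v) = 2 * sin v * cis (v - pi / 2)\<close>
  extracts the sine power. The remaining phase agrees with that in \<open>sin_cos_integral\<close>
  up to sign and a multiple of \<open>pi\<close>, which the absolute value absorbs.\<close>

lemma sin_cos_kernel:
  assumes "n \<ge> 1"
  shows "\<bar>Re (cis \<alpha> * (cis (- (2 * real n * v)) * (1 - cis (2 * v)) ^ (n - 1)))\<bar>
    = 2 ^ (n - 1) * \<bar>sin v ^ (n - 1) * cos (v * (real n + 1) + - \<alpha> - pi / 2 * (real n - 1))\<bar>"
proof -
  define X where "X = v * (real n + 1) + - \<alpha> - pi / 2 * (real n - 1)"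
  have "1 - cis (2 * v) = of_real (2 * sin v) * cis (v - pi / 2)"
    by (simp add: complex_eq_iff cos_diff sin_diff cos_double_sin sin_double power2_eq_square)
  then have "cis \<alpha> * (cis (- (2 * real n * v)) * (1 - cis (2 * v)) ^ (n - 1))
      = of_real ((2 * sin v) ^ (n - 1)) * (cis \<alpha> * cis (- (2 * real n * v)) * cis (real (n - 1) * (v - pi / 2)))"
    by (simp add: power_mult_distrib Complex.DeMoivre mult_ac)
  also have "cis \<alpha> * cis (- (2 * real n * v)) * cis (real (n - 1) * (v - pi / 2))
      = cis (- (X + of_int (int n - 1) * pi))"
    using assms by (simp add: cis_mult X_def of_nat_diff) (simp add: field_simps)
  finally have "\<bar>Re (cis \<alpha> * (cis (- (2 * real n * v)) * (1 - cis (2 * v)) ^ (n - 1)))\<bar>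
      = \<bar>(2 * sin v) ^ (n - 1)\<bar> * \<bar>cos (X + of_int (int n - 1) * pi)\<bar>"
    by (simp only: times_complex.sel Re_complex_of_real Im_complex_of_real cis.sel cos_minus)
      (simp add: abs_mult)
  then show ?thesis
    unfolding abs_cos_add_int_pi by (simp add: X_def abs_mult power_mult_distrib)
qed

text \<open>The binomial expansion of the kernel \<open>K\<close> has exactly the coefficients of
  the sum, each at the frequency that extracts the matching Taylor coefficient. So the sum is
  \<open>2 / pi\<close> times the integral of \<open>Re g\<close> against \<open>K\<close>.\<close>

lemma taylor_sum_bound_minus_one:
  fixes g :: "complex \<Rightarrow> complex"
  assumes g: "g holomorphic_on ball 0 1" and Re_g: "\<And>w. cmod w < 1 \<Longrightarrow> \<bar>Re (g w)\<bar> \<le> 1"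
    and n: "n \<ge> 1"
  shows "cmod (\<Sum>k<n. of_nat (n - 1 choose k) * (-1) ^ k * ((deriv ^^ (n - k)) g 0 / fact (n - k)))
    \<le> 2 ^ n / pi * (SUP \<beta>\<in>{0..pi/2}. sin_cos_integral n \<beta>)"
    (is "cmod (\<Sum>k<n. ?b k * ?g k) \<le> ?B")
proof -
  \<comment> \<open>This is the sum for \<open>g\<close> dilated by \<open>\<rho>\<close>: boundary
    values on the unit circle need not exist, so the estimate is made on smaller circles.\<close>
  define X where "X \<rho> = (\<Sum>k<n. ?b k * (of_real \<rho> ^ (n - k) * ?g k))" for \<rho> :: real
  define K where "K v = cis (- (2 * real n * v)) * (1 - cis (2 * v)) ^ (n - 1)" for v
  have K: "K v = (\<Sum>k<n. ?b k * cis (- (2 * real (n - k) * v)))" for v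
  proof -
    have "(1 - cis (2 * v)) ^ (n - 1) = (- cis (2 * v) + 1) ^ (n - 1)"
      by simp
    also have "\<dots> = (\<Sum>k\<le>n - 1. of_nat (n - 1 choose k) * (- cis (2 * v)) ^ k)"
      by (subst binomial_ring) simp
    also have "\<dots> = (\<Sum>k<n. ?b k * cis (real k * (2 * v)))"
      using n by (intro sum.cong) (auto simp: Complex.DeMoivre power_minus[of "cis _"])
    finally have "K v = (\<Sum>k<n. ?b k * (cis (- (2 * real n * v)) * cis (real k * (2 * v))))"
      unfolding K_def by (simp only: sum_distrib_left mult.left_commute)
    also have "\<dots> = (\<Sum>k<n. ?b k * cis (- (2 * real (n - k) * v)))"
      unfolding cis_mult by (intro sum.cong refl) (simp add: of_nat_diff algebra_simps)
    finally show ?thesis .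
  qed
  have bound: "cmod (X \<rho>) \<le> ?B" if \<rho>: "0 < \<rho>" "\<rho> < 1" for \<rho>
  proof -
    let ?u = "\<lambda>v. Re (g (of_real \<rho> * cis (2 * v)))"
    \<comment> \<open>Rotating \<open>X \<rho>\<close> onto the nonnegative real axis makes its
      modulus the integral of a real part.\<close>
    define \<alpha> where "\<alpha> = - Arg (X \<rho>)"
    have "((\<lambda>v. \<Sum>k<n. ?b k * (of_real (?u v) * cis (- (2 * real (n - k) * v))))
        has_integral (\<Sum>k<n. ?b k * (of_real (pi / 2 * \<rho> ^ (n - k)) * ?g k))) {0..pi}"
      by (intro has_integral_sum has_integral_mult_right circle_moment g \<rho>) auto
    then have "((\<lambda>v. of_real (?u v) * K v) has_integral of_real (pi / 2) * X \<rho>) {0..pi}"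
      unfolding K X_def sum_distrib_left by (simp add: mult_ac)
    then have "((\<lambda>v. Re (cis \<alpha> * (of_real (?u v) * K v)))
        has_integral Re (cis \<alpha> * (of_real (pi / 2) * X \<rho>))) {0..pi}"
      by (intro has_integral_Re has_integral_mult_right)
    moreover have "cis \<alpha> * X \<rho> = of_real (cmod (X \<rho>))"
    proof -
      have "X \<rho> = of_real (cmod (X \<rho>)) * cis (Arg (X \<rho>))"
        by (metis rcis_cmod_Arg rcis_def)
      then have "cis \<alpha> * X \<rho> = of_real (cmod (X \<rho>)) * (cis (Arg (X \<rho>)) * cis \<alpha>)"
        by (metis mult.commute mult.left_commute)
      then show ?thesis by (simp add: \<alpha>_def cis_mult)
    qed
    then have "cis \<alpha> * (of_real (pi / 2) * X \<rho>) = of_real (pi / 2 * cmod (X \<rho>))"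
      by (simp add: mult.left_commute)
    moreover have "Re (cis \<alpha> * (of_real (?u v) * K v)) = ?u v * Re (cis \<alpha> * K v)" for v
      by (simp add: algebra_simps)
    ultimately have "((\<lambda>v. ?u v * Re (cis \<alpha> * K v)) has_integral pi / 2 * cmod (X \<rho>)) {0..pi}"
      by (simp only: Re_complex_of_real)
    moreover have "((\<lambda>v. 2 ^ (n - 1) * \<bar>sin v ^ (n - 1) * cos (v * (real n + 1) + - \<alpha> - pi / 2 * (real n - 1))\<bar>)
        has_integral 2 ^ (n - 1) * sin_cos_integral n (- \<alpha>)) {0..pi}"
      by (intro has_integral_mult_right sin_cos_integral_has_integral)
    ultimately have "pi / 2 * cmod (X \<rho>) \<le> 2 ^ (n - 1) * sin_cos_integral n (- \<alpha>)"
    proof (rule has_integral_le)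
      fix v
      have "?u v * Re (cis \<alpha> * K v) \<le> \<bar>?u v\<bar> * \<bar>Re (cis \<alpha> * K v)\<bar>"
        by (metis abs_ge_self abs_mult)
      also have "\<dots> \<le> 1 * \<bar>Re (cis \<alpha> * K v)\<bar>"
        using \<rho> by (intro mult_right_mono Re_g) (auto simp: norm_mult)
      finally show "?u v * Re (cis \<alpha> * K v)
          \<le> 2 ^ (n - 1) * \<bar>sin v ^ (n - 1) * cos (v * (real n + 1) + - \<alpha> - pi / 2 * (real n - 1))\<bar>"
        using sin_cos_kernel[OF n] by (simp only: K_def mult_1)
    qed
    also have "\<dots> \<le> 2 ^ (n - 1) * (SUP \<beta>\<in>{0..pi/2}. sin_cos_integral n \<beta>)"
      by (intro mult_left_mono sin_cos_integral_le_SUP) auto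
    finally show ?thesis
      using n by (cases n) (auto simp: field_simps)
  qed
  \<comment> \<open>\<open>X\<close> is a polynomial in \<open>\<rho>\<close>, so the uniform bound
    passes to \<open>\<rho> = 1\<close>.\<close>
  have "(X \<longlongrightarrow> X 1) (at_left 1)"
    unfolding X_def by (intro tendsto_intros)
  then have "((\<lambda>\<rho>. cmod (X \<rho>)) \<longlongrightarrow> cmod (X 1)) (at_left 1)"
    by (rule tendsto_norm)
  moreover have "eventually (\<lambda>\<rho>. cmod (X \<rho>) \<le> ?B) (at_left 1)"
    using eventually_at_left_real[OF zero_less_one] by eventually_elim (rule bound, auto)
  ultimately have "cmod (X 1) \<le> ?B"
    by (rule tendsto_upperbound) auto
  then show ?thesis by (simp add: X_def)
qed

text \<open>The sum is a polynomial in \<open>s\<close>, so the unit circle suffices. There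
  \<open>- cnj s\<close> has modulus 1, and precomposing \<open>g\<close> with this rotation turns
  the sum at \<open>s\<close> into the unimodular factor \<open>(- s) ^ n\<close> times a sum at
  \<open>-1\<close>.\<close>

lemma taylor_sum_bound:
  fixes g :: "complex \<Rightarrow> complex"
  assumes g: "g holomorphic_on ball 0 1" and Re_g: "\<And>w. cmod w < 1 \<Longrightarrow> \<bar>Re (g w)\<bar> \<le> 1"
    and n: "n \<ge> 1" and s: "cmod s \<le> 1"
  shows "cmod (\<Sum>k<n. of_nat (n - 1 choose k) * s ^ k * ((deriv ^^ (n - k)) g 0 / fact (n - k)))
    \<le> 2 ^ n / pi * (SUP \<beta>\<in>{0..pi/2}. sin_cos_integral n \<beta>)"
proof (rule maximum_modulus_frontier[where S = "cball 0 1" and \<xi> = s and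
      f = "\<lambda>s. \<Sum>k<n. of_nat (n - 1 choose k) * s ^ k * ((deriv ^^ (n - k)) g 0 / fact (n - k))"])
  show "s \<in> cball 0 1" using s by simp
next
  fix s :: complex assume "s \<in> frontier (cball 0 1)"
  then have s: "cmod s = 1" by simp
  then have ss: "s * cnj s = 1" by (simp add: complex_norm_square[symmetric])
  have coeff: "(deriv ^^ j) (\<lambda>w. g (- cnj s * w)) 0 = (- cnj s) ^ j * (deriv ^^ j) g 0" for j
    using higher_deriv_compose_linear[of g "ball 0 1" "ball 0 1" 0 "- cnj s" j] g s
    by (simp add: norm_mult)
  have "(\<Sum>k<n. of_nat (n - 1 choose k) * s ^ k * ((deriv ^^ (n - k)) g 0 / fact (n - k)))
      = (- s) ^ n * (\<Sum>k<n. of_nat (n - 1 choose k) * (-1) ^ k *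
          ((deriv ^^ (n - k)) (\<lambda>w. g (- cnj s * w)) 0 / fact (n - k)))"
    unfolding sum_distrib_left
  proof (rule sum.cong[OF refl])
    fix k assume "k \<in> {..<n}"
    then have "(- s) ^ n = (- s) ^ k * (- s) ^ (n - k)"
      by (simp flip: power_add)
    then have "(- s) ^ n * (-1) ^ k * (- cnj s) ^ (n - k) = ((- s) * (-1)) ^ k * ((- s) * (- cnj s)) ^ (n - k)"
      by (simp only: power_mult_distrib mult_ac)
    then have "(- s) ^ n * (-1) ^ k * (- cnj s) ^ (n - k) = s ^ k"
      by (simp add: ss)
    then show "of_nat (n - 1 choose k) * s ^ k * ((deriv ^^ (n - k)) g 0 / fact (n - k))
        = (- s) ^ n * (of_nat (n - 1 choose k) * (-1) ^ k *
          ((deriv ^^ (n - k)) (\<lambda>w. g (- cnj s * w)) 0 / fact (n - k)))"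
      unfolding coeff by (simp add: mult_ac)
  qed
  moreover have "(\<lambda>w. g (- cnj s * w)) holomorphic_on ball 0 1"
    using g s holomorphic_on_compose_gen[of "\<lambda>w. - cnj s * w" "ball 0 1" g "ball 0 1", unfolded o_def]
    by (simp add: image_subset_iff norm_mult holomorphic_intros)
  ultimately show "cmod (\<Sum>k<n. of_nat (n - 1 choose k) * s ^ k * ((deriv ^^ (n - k)) g 0 / fact (n - k)))
      \<le> 2 ^ n / pi * (SUP \<beta>\<in>{0..pi/2}. sin_cos_integral n \<beta>)"
    using taylor_sum_bound_minus_one[of "\<lambda>w. g (- cnj s * w)" n] Re_g n s
    by (simp add: norm_mult norm_power)
qed (auto intro!: holomorphic_intros continuous_intros)

text \<open>The Moebius map sends the disc into itself and 0 to \<open>z\<close>, so the transported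
  function keeps the bound on its real part; the polynomial is then evaluated at
  \<open>s = cnj z\<close>.\<close>

lemma unit_disc_deriv_bound:
  fixes h :: "complex \<Rightarrow> complex"
  assumes h: "h holomorphic_on ball 0 1" and Re_h: "\<And>w. cmod w < 1 \<Longrightarrow> \<bar>Re (h w)\<bar> \<le> 1"
    and n: "n \<ge> 1" and z: "cmod z < 1"
  shows "cmod ((deriv ^^ n) h z) * (1 - (cmod z)\<^sup>2) ^ n \<le> C_inf n"
proof -
  define M where "M = Moebius_function 0 (- z)"
  have M: "M w = (w + z) / (1 + cnj z * w)" for w
    by (simp add: M_def Moebius_function_simple)
  have Mn: "cmod (M w) < 1" if "cmod w < 1" for w
    unfolding M_def using that z by (intro Moebius_function_norm_lt_1) auto
  have "M holomorphic_on ball 0 1"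
    unfolding M_def using z by (intro Moebius_function_holomorphic) auto
  then have "(\<lambda>w. h (M w)) holomorphic_on ball 0 1"
    using holomorphic_on_compose_gen[of M "ball 0 1" h "ball 0 1", unfolded o_def] h Mn
    by (simp add: image_subset_iff)
  then have "cmod ((deriv ^^ n) h z / fact n * of_real (1 - (cmod z)\<^sup>2) ^ n)
      \<le> 2 ^ n / pi * (SUP \<beta>\<in>{0..pi/2}. sin_cos_integral n \<beta>)"
    unfolding taylor_coeff_moebius[OF h z n, folded M]
    using Re_h Mn n z by (intro taylor_sum_bound) auto
  moreover have "(cmod z)\<^sup>2 \<le> 1"
    using z by (simp add: power_le_one)
  ultimately show ?thesis
    by (simp add: norm_mult norm_divide norm_power C_inf_def field_simps
        del: of_real_diff of_real_power)
qed

section \<open>The constant for odd order\<close>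

text \<open>This is the binomial expansion of
  \<open>2 * sin v = \<i> * cis (- v) * (1 - cis (2 * v))\<close>. What matters later is that the
  frequencies are \<open>2 * d\<close> with integers \<open>d\<close> of modulus at most
  \<open>N\<close>.\<close>

lemma sin_power_even_cis_sum:
  "complex_of_real (sin v ^ (2 * N)) =
    (\<Sum>k\<le>2 * N. of_real ((-1) ^ (N + k) * real (2 * N choose k) / 4 ^ N) * cis (2 * (real k - real N) * v))"
proof -
  have "complex_of_real (2 * sin v) = \<i> * cis (- v) * (- cis (2 * v) + 1)"
  proof -
    have "\<i> * cis (- v) * (- cis (2 * v) + 1) = \<i> * (cis (- v) - cis (- v) * cis (2 * v))"
      by (simp add: algebra_simps)
    also have "\<dots> = complex_of_real (2 * sin v)"
      unfolding cis_mult by (simp add: complex_eq_iff)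
    finally show ?thesis ..
  qed
  then have "complex_of_real (2 * sin v) ^ (2 * N)
      = (\<i> * cis (- v)) ^ (2 * N) * (- cis (2 * v) + 1) ^ (2 * N)"
    by (simp only: power_mult_distrib)
  also have "(\<i> * cis (- v)) ^ (2 * N) = (-1) ^ N * cis (- (2 * real N * v))"
    by (simp add: power_mult_distrib power_mult[of \<i>] Complex.DeMoivre)
  also have "(- cis (2 * v) + 1) ^ (2 * N) = (\<Sum>k\<le>2 * N. of_nat (2 * N choose k) * (- cis (2 * v)) ^ k)"
    by (subst binomial_ring) simp
  also have "\<dots> = (\<Sum>k\<le>2 * N. (-1) ^ k * of_nat (2 * N choose k) * cis (real k * (2 * v)))"
    by (intro sum.cong) (auto simp: Complex.DeMoivre power_minus[of "cis _"])
  finally have "complex_of_real (2 * sin v) ^ (2 * N) =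
      (\<Sum>k\<le>2 * N. (-1) ^ (N + k) * of_nat (2 * N choose k) * cis (2 * (real k - real N) * v))"
    unfolding sum_distrib_left
    by (auto intro!: sum.cong simp: power_add cis_mult mult_ac algebra_simps)
  moreover have "complex_of_real (2 * sin v) ^ (2 * N) = 4 ^ N * complex_of_real (sin v ^ (2 * N))"
    by (simp add: power_mult_distrib power_mult)
  ultimately have "complex_of_real (sin v ^ (2 * N)) =
      (\<Sum>k\<le>2 * N. (-1) ^ (N + k) * of_nat (2 * N choose k) * cis (2 * (real k - real N) * v)) / 4 ^ N"
    by (simp add: field_simps)
  then show ?thesis
    by (simp add: sum_divide_distrib)
qed

text \<open>A geometric sum whose ratio is an \<open>L\<close>-th root of unity, different from 1
  because \<open>L\<close> does not divide \<open>d\<close>.\<close>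

lemma sum_cis_equidistant:
  fixes d :: int
  assumes "d \<noteq> 0" "\<bar>d\<bar> < int L"
  shows "(\<Sum>j<L. cis (2 * of_int d * (v + real j * (pi / real L)))) = 0"
proof -
  define \<omega> where "\<omega> = cis (2 * of_int d * (pi / real L))"
  have L: "L > 0" using assms by (cases L) auto
  have "\<omega> \<noteq> 1"
  proof
    assume "\<omega> = 1"
    then have "cos (2 * of_int d * (pi / real L)) = 1"
      by (simp add: \<omega>_def complex_eq_iff)
    then obtain k :: int where "2 * of_int d * (pi / real L) = of_int k * 2 * pi"
      by (auto simp: cos_one_2pi_int)
    then have "real_of_int d = real_of_int (k * int L)"
      using L by (simp add: field_simps)
    then have "d = k * int L" by (simp only: of_int_eq_iff)
    with assms show False
      by (cases "k = 0") (auto simp: abs_mult)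
  qed
  have "\<omega> ^ L = 1"
  proof -
    have "real L * (2 * of_int d * (pi / real L)) = 2 * pi * of_int d"
      using L by simp
    then show ?thesis
      unfolding \<omega>_def Complex.DeMoivre by (simp add: cis_multiple_2pi)
  qed
  have "(\<Sum>j<L. cis (2 * of_int d * (v + real j * (pi / real L)))) = cis (2 * of_int d * v) * (\<Sum>j<L. \<omega> ^ j)"
    unfolding sum_distrib_left \<omega>_def Complex.DeMoivre cis_mult
    by (simp add: algebra_simps)
  also have "\<dots> = 0"
    using \<open>\<omega> \<noteq> 1\<close> \<open>\<omega> ^ L = 1\<close> by (simp add: geometric_sum)
  finally show ?thesis .
qed

text \<open>Averaging over \<open>L > N\<close> equidistant points kills every frequency except the
  constant term \<open>k = N\<close>.\<close>

lemma sum_sin_power_even_equidistant: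
  assumes "N < L"
  shows "(\<Sum>j<L. sin (v + real j * (pi / real L)) ^ (2 * N)) = real L * real (2 * N choose N) / 4 ^ N"
proof -
  let ?c = "\<lambda>k. complex_of_real ((-1) ^ (N + k) * real (2 * N choose k) / 4 ^ N)"
  have "complex_of_real (\<Sum>j<L. sin (v + real j * (pi / real L)) ^ (2 * N))
      = (\<Sum>k\<le>2 * N. ?c k * (\<Sum>j<L. cis (2 * (real k - real N) * (v + real j * (pi / real L)))))"
    unfolding of_real_sum sin_power_even_cis_sum sum_distrib_left by (rule sum.swap)
  also have "\<dots> = (\<Sum>k\<le>2 * N. if k = N then ?c k * of_nat L else 0)"
  proof (rule sum.cong[OF refl])
    fix k assume "k \<in> {..2 * N}"
    then show "?c k * (\<Sum>j<L. cis (2 * (real k - real N) * (v + real j * (pi / real L))))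
        = (if k = N then ?c k * of_nat L else 0)"
      using sum_cis_equidistant[of "int k - int N" L v] assms by auto
  qed
  also have "\<dots> = complex_of_real (real L * real (2 * N choose N) / 4 ^ N)"
    by (simp add: mult_ac)
  finally show ?thesis
    by (simp only: of_real_eq_iff)
qed

lemma integral_shift_zero:
  fixes f :: "real \<Rightarrow> real"
  assumes "continuous_on UNIV f"
  shows "integral {c..c + h} f = integral {0..h} (\<lambda>v. f (v + c))"
proof -
  have "(f has_integral integral {c..c + h} f) (cbox c (c + h))"
    by (simp, intro integrable_integral integrable_continuous_real continuous_on_subset[OF assms]) auto
  from has_integral_affinity'[OF this, of 1 c] show ?thesis
    by (simp add: integral_unique)
qed

text \<open>Folds an integral over \<open>L\<close> intervals of length \<open>h\<close> onto the
  first one, in preparation for an \<open>h\<close>-periodic factor.\<close>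

lemma integral_sum_shifts:
  fixes f :: "real \<Rightarrow> real"
  assumes f: "continuous_on UNIV f" and h: "h \<ge> 0"
  shows "integral {0..real L * h} f = integral {0..h} (\<lambda>v. \<Sum>j<L. f (v + real j * h))"
proof -
  have int: "f integrable_on {a..b}" for a b
    by (intro integrable_continuous_real continuous_on_subset[OF f]) auto
  have "integral {0..real L * h} f = (\<Sum>j<L. integral {0..h} (\<lambda>v. f (v + real j * h)))"
  proof (induction L)
    case (Suc L)
    have "integral {0..real L * h} f + integral {real L * h..real L * h + h} f
        = integral {0..real L * h + h} f"
      using h int by (intro Henstock_Kurzweil_Integration.integral_combine) auto
    moreover have "real (Suc L) * h = real L * h + h"
      by (simp add: algebra_simps)
    ultimately show ?case
      by (simp only: Suc.IH sum.lessThan_Suc integral_shift_zero[OF f])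
  qed simp
  also have "\<dots> = integral {0..h} (\<lambda>v. \<Sum>j<L. f (v + real j * h))"
    by (rule integral_sum[symmetric])
       (auto intro!: integrable_continuous_real continuous_intros continuous_on_compose2[OF f])
  finally show ?thesis .
qed

text \<open>The cosine changes sign at \<open>u = pi / 2 - \<beta>\<close>; the pieces
  \<open>1 - sin \<beta>\<close> and \<open>1 + sin \<beta>\<close> add up to 2.\<close>

lemma has_integral_abs_cos_shift:
  assumes "0 \<le> \<beta>" "\<beta> \<le> pi / 2"
  shows "((\<lambda>u. \<bar>cos (u + \<beta>)\<bar>) has_integral 2) {0..pi}"
proof -
  have d: "((\<lambda>u. c * sin (u + \<beta>)) has_vector_derivative c * cos (u + \<beta>)) (at u within A)" for c u A
    by (auto intro!: derivative_eq_intros simp flip: has_real_derivative_iff_has_vector_derivative)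
  have 1: "((\<lambda>u. \<bar>cos (u + \<beta>)\<bar>) has_integral 1 - sin \<beta>) {0..pi / 2 - \<beta>}"
  proof (rule has_integral_eq)
    show "((\<lambda>u. 1 * cos (u + \<beta>)) has_integral 1 - sin \<beta>) {0..pi / 2 - \<beta>}"
      using fundamental_theorem_of_calculus[OF _ d, of 0 "pi / 2 - \<beta>" 1] assms by simp
    show "1 * cos (u + \<beta>) = \<bar>cos (u + \<beta>)\<bar>" if "u \<in> {0..pi / 2 - \<beta>}" for u
      using that assms by (simp add: cos_ge_zero)
  qed
  have 2: "((\<lambda>u. \<bar>cos (u + \<beta>)\<bar>) has_integral 1 + sin \<beta>) {pi / 2 - \<beta>..pi}"
  proof (rule has_integral_eq)
    show "((\<lambda>u. (-1) * cos (u + \<beta>)) has_integral 1 + sin \<beta>) {pi / 2 - \<beta>..pi}"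
      using fundamental_theorem_of_calculus[OF _ d, of "pi / 2 - \<beta>" pi "-1"] assms
      by (simp add: add.commute)
    show "(-1) * cos (u + \<beta>) = \<bar>cos (u + \<beta>)\<bar>" if "u \<in> {pi / 2 - \<beta>..pi}" for u
      using that assms cos_ge_zero[of "u + \<beta> - pi"] by (auto simp: cos_diff)
  qed
  show ?thesis
    using has_integral_combine[OF _ _ 1 2] assms by simp
qed

text \<open>Here \<open>n = 2 * N + 1\<close> and \<open>L = n + 1\<close>. Folding onto one period
  \<open>pi / L\<close> of the cosine factor replaces the sine power by its constant equidistant sum
  and leaves \<open>2 / L\<close> for the cosine, whatever the phase.\<close>

lemma sin_cos_integral_odd:
  assumes \<beta>: "0 \<le> \<beta>" "\<beta> \<le> pi / 2"
  shows "sin_cos_integral (2 * N + 1) \<beta> = 2 * real (2 * N choose N) / 4 ^ N"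
proof -
  define L where "L = 2 * N + 2"
  define h where "h = pi / real L"
  have L: "real L > 0" "N < L" by (simp_all add: L_def)
  have h: "h > 0" "real L * h = pi" using L by (simp_all add: h_def)
  \<comment> \<open>For odd \<open>n\<close> the shift \<open>pi / 2 * (n - 1)\<close> is the
    multiple \<open>N * pi\<close>, invisible under the absolute value.\<close>
  have "v * (real (2 * N + 1) + 1) + \<beta> - pi / 2 * (real (2 * N + 1) - 1)
      = (real L * v + \<beta>) + of_int (- int N) * pi" for v
    by (simp add: L_def algebra_simps)
  then have "sin_cos_integral (2 * N + 1) \<beta>
      = integral {0..real L * h} (\<lambda>v. sin v ^ (2 * N) * \<bar>cos (real L * v + \<beta>)\<bar>)"
    unfolding sin_cos_integral_def h(2) abs_mult abs_cos_add_int_pi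
    by (simp only: abs_cos_add_int_pi) (simp add: power_mult)
  also have "\<dots> = integral {0..h} (\<lambda>v. \<Sum>j<L. sin (v + real j * h) ^ (2 * N) *
      \<bar>cos (real L * (v + real j * h) + \<beta>)\<bar>)"
    using h by (intro integral_sum_shifts continuous_intros) auto
  also have "\<dots> = integral {0..h} (\<lambda>v. real L * real (2 * N choose N) / 4 ^ N * \<bar>cos (real L * v + \<beta>)\<bar>)"
  proof -
    have "real L * (v + real j * h) + \<beta> = (real L * v + \<beta>) + of_int (int j) * pi" for v j
      using h(2) by (simp add: algebra_simps)
    then show ?thesis
      using sum_sin_power_even_equidistant[OF L(2)]
      by (simp only: abs_cos_add_int_pi sum_distrib_right[symmetric] h_def)
  qed
  also have "\<dots> = real L * real (2 * N choose N) / 4 ^ N * integral {0..h} (\<lambda>v. \<bar>cos (real L * v + \<beta>)\<bar>)"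
    by simp
  also have "integral {0..h} (\<lambda>v. \<bar>cos (real L * v + \<beta>)\<bar>) = 2 / real L"
    using has_integral_affinity'[OF has_integral_abs_cos_shift[OF \<beta>, folded cbox_interval] L(1), of 0] L(1)
    by (simp add: h_def integral_unique field_simps)
  finally show ?thesis using L by simp
qed

lemma C_inf_odd:
  assumes "m \<ge> 1" "n = 2 * m - 1"
  shows "C_inf n = 1 / (real n * pi) * ((fact (2 * m))\<^sup>2 / (fact m)\<^sup>2)"
proof -
  obtain N where m: "m = Suc N" using assms by (cases m) auto
  have n: "n = 2 * N + 1" using assms m by simp
  obtain \<beta>0 where "\<beta>0 \<in> {0..pi / 2}"
    "sin_cos_integral n \<beta>0 = (SUP \<beta>\<in>{0..pi/2}. sin_cos_integral n \<beta>)"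
    by (metis sin_cos_integral_attains_SUP)
  then have "C_inf n = fact n / pi * 2 ^ n * (2 * real (2 * N choose N) / 4 ^ N)"
    unfolding C_inf_def n using sin_cos_integral_odd[of \<beta>0 N] by simp
  also have "real (2 * N choose N) = fact (2 * N) / (fact N * fact N)"
    by (simp add: binomial_fact)
  also have "fact n / pi * 2 ^ n * (2 * (fact (2 * N) / (fact N * fact N)) / 4 ^ N)
      = 4 * fact (2 * N + 1) * fact (2 * N) / (pi * (fact N)\<^sup>2)"
  proof -
    have "(2::real) ^ n = 2 * 4 ^ N"
      by (simp add: n power_mult)
    then show ?thesis
      by (simp add: n power2_eq_square del: fact_Suc)
  qed
  also have "\<dots> = 1 / (real n * pi) * ((fact (2 * m))\<^sup>2 / (fact m)\<^sup>2)"
  proof -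
    have a: "fact (2 * N + 1) = (2 * real N + 1) * fact (2 * N)"
      by (simp add: algebra_simps)
    have b: "fact (2 * m) = (2 * (real N + 1)) * ((2 * real N + 1) * fact (2 * N))"
      using a by (simp add: m algebra_simps)
    have c: "fact m = (real N + 1) * fact N"
      by (simp add: m algebra_simps)
    have "real N + 1 \<noteq> 0" "2 * real N + 1 \<noteq> 0" by linarith+
    then show ?thesis
      unfolding a b c n power_mult_distrib
      by (simp add: divide_simps power2_eq_square)
  qed
  finally show ?thesis .
qed

section \<open>From the unit disc to the domain\<close>

text \<open>By continuity the set where the bound fails is open; being null as well, it is
  empty.\<close>

lemma linf_norm_le_imp_abs_le:
  assumes S: "open S" and g: "continuous_on S g"
    and norm: "linf_norm S g \<le> ereal c" and w: "w \<in> S"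
  shows "\<bar>g w\<bar> \<le> c"
proof -
  define U where "U = {w \<in> S. \<bar>g w\<bar> > c}"
  have "open U"
  proof -
    have "U = S \<inter> (\<lambda>w. \<bar>g w\<bar>) -` {c<..}" by (auto simp: U_def)
    moreover have "open \<dots>"
      using S by (intro continuous_open_preimage) (auto intro!: continuous_intros g)
    ultimately show ?thesis by simp
  qed
  have "AE w in lebesgue_on S. ereal \<bar>g w\<bar> \<le> esssup (lebesgue_on S) (\<lambda>w. ereal \<bar>g w\<bar>)"
    by (rule esssup_AE)
  then have "AE w in lebesgue_on S. \<bar>g w\<bar> \<le> c"
    by eventually_elim (use norm in \<open>auto simp: linf_norm_def dest: order_trans\<close>)
  then have "AE w \<in> S in lebesgue. w \<in> - U"
    using S by (subst (asm) AE_restrict_space_iff) (auto simp: U_def elim!: eventually_mono)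
  then have "w \<in> - U"
    using mem_closed_if_AE_lebesgue_open[OF S _ _ w, of "- U"] \<open>open U\<close> by auto
  with w show ?thesis by (auto simp: U_def)
qed

text \<open>A connected ball that meets \<open>S\<close> and leaves it would meet the frontier
  closer to \<open>w\<close> than \<open>bdist S w\<close>. For an empty frontier
  \<open>infdist\<close> is 0 and the ball is empty.\<close>

lemma ball_bdist_subset:
  assumes "w \<in> S"
  shows "ball w (bdist S w) \<subseteq> S"
proof (rule ccontr)
  assume *: "\<not> ball w (bdist S w) \<subseteq> S"
  then have "bdist S w > 0"
    by (auto simp: dist_norm intro: le_less_trans[OF norm_ge_zero])
  then have "w \<in> ball w (bdist S w)" by simp
  with * assms have "ball w (bdist S w) \<inter> frontier S \<noteq> {}"
    by (intro connected_Int_frontier connected_ball) blast+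
  then obtain x where "x \<in> frontier S" "dist w x < bdist S w" by auto
  then show False
    using infdist_le[of x "frontier S" w] by (simp add: bdist_def)
qed

text \<open>Rescaling to the unit disc sends \<open>z\<close> to a point \<open>u\<close> of modulus
  \<open>1 - d / R\<close>. The factor \<open>2 - d / R\<close> is \<open>1 + cmod u\<close> in the
  factorization of \<open>1 - (cmod u)\<^sup>2\<close>.\<close>

lemma disc_deriv_bound:
  fixes f :: "complex \<Rightarrow> complex"
  assumes f: "f holomorphic_on ball \<zeta> R" and Re_f: "\<And>w. w \<in> ball \<zeta> R \<Longrightarrow> \<bar>Re (f w)\<bar> \<le> 1"
    and n: "n \<ge> 1" and z: "z \<in> ball \<zeta> R"
  defines "d \<equiv> R - dist \<zeta> z"
  shows "(d * (2 - d / R)) ^ n * cmod ((deriv ^^ n) f z) \<le> C_inf n"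
proof -
  have R: "R > 0" using z by (auto intro: le_less_trans[OF zero_le_dist])
  define h where "h = (\<lambda>w. f (of_real R * w + \<zeta>))"
  define u where "u = (z - \<zeta>) / of_real R"
  have maps: "of_real R * w + \<zeta> \<in> ball \<zeta> R" if "w \<in> ball 0 1" for w
    using that R by (simp add: dist_norm norm_mult)
  have u: "u \<in> ball 0 1" "of_real R * u + \<zeta> = z"
    using z R by (auto simp: u_def dist_norm norm_divide norm_minus_commute)
  have "h holomorphic_on ball 0 1"
    unfolding h_def using maps
    by (intro holomorphic_on_compose_gen[OF _ f, unfolded o_def] holomorphic_intros) auto
  then have "cmod ((deriv ^^ n) h u) * (1 - (cmod u)\<^sup>2) ^ n \<le> C_inf n"
    using Re_f maps n u by (intro unit_disc_deriv_bound) (auto simp: h_def)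
  moreover have "(deriv ^^ n) h u = of_real R ^ n * (deriv ^^ n) f z"
    unfolding h_def using higher_deriv_compose_linear'[OF f _ _ u(1) maps] u by simp
  moreover have "cmod u = 1 - d / R"
    using R by (simp add: u_def d_def dist_norm norm_divide norm_minus_commute field_simps)
  then have "1 - (cmod u)\<^sup>2 = d / R * (2 - d / R)"
    by (simp only:) (simp add: power2_eq_square algebra_simps)
  ultimately show ?thesis
    using R by (simp add: norm_mult norm_power power_mult_distrib power_divide mult_ac)
qed

theorem corollary1p6:
  fixes \<Omega> :: "complex set" and f :: "complex \<Rightarrow> complex"
    and z a \<zeta> :: complex and n :: nat
  assumes "open \<Omega>" and "connected \<Omega>"
    and "n \<ge> 1"
    and "z \<in> \<Omega>"
    and "a \<in> frontier \<Omega>" and "cmod (z - a) = bdist \<Omega> z"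
    and "maximal_contact_point \<Omega> a z \<zeta>"
    and "f holomorphic_on \<Omega>"
    and "linf_norm \<Omega> (\<lambda>w. Re (f w)) < \<infinity>"
    and "linf_norm \<Omega> (\<lambda>w. Re (f w)) \<le> 1"
  shows "bdist \<Omega> z ^ n * cmod ((deriv ^^ n) f z)
           \<le> C_inf n / (2 - bdist \<Omega> z / bdist \<Omega> \<zeta>) ^ n
       \<and> (\<forall>m::nat. m \<ge> 1 \<and> n = 2 * m - 1 \<longrightarrow>
            bdist \<Omega> z ^ (2 * m - 1) * cmod ((deriv ^^ (2 * m - 1)) f z)
              \<le> 1 / (real n * pi) * ((fact (2 * m))\<^sup>2 / (fact m)\<^sup>2)
                  * (1 / (2 - bdist \<Omega> z / bdist \<Omega> \<zeta>) ^ n))"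
proof -
  let ?R = "bdist \<Omega> \<zeta>" and ?d = "bdist \<Omega> z"
  have \<zeta>: "\<zeta> \<in> \<Omega>" "z \<in> closed_segment \<zeta> a" "?R = cmod (\<zeta> - a)"
    using assms(7) by (auto simp: maximal_contact_point_def contact_point_def)
  \<comment> \<open>Since \<open>z\<close> lies between \<open>\<zeta>\<close> and \<open>a\<close>,
    its distance to the frontier equals its distance to the circle about \<open>\<zeta>\<close>
    through \<open>a\<close>.\<close>
  then have "dist \<zeta> a = dist \<zeta> z + dist z a"
    using between between_mem_segment by blast
  then have d: "?d = ?R - dist \<zeta> z"
    using \<zeta> assms(6) by (simp add: dist_norm)
  \<comment> \<open>An open set misses its frontier. The resulting \<open>?d > 0\<close> puts
    \<open>z\<close> inside the open disc about \<open>\<zeta>\<close>.\<close>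
  have "z \<noteq> a"
    using assms(1,4,5) by (auto simp: frontier_def interior_open)
  then have "?d > 0"
    unfolding assms(6)[symmetric] by simp
  have sub: "ball \<zeta> ?R \<subseteq> \<Omega>"
    using \<zeta>(1) by (rule ball_bdist_subset)
  have Re_f: "\<bar>Re (f w)\<bar> \<le> 1" if "w \<in> \<Omega>" for w
    using assms(1,8,10) that
    by (intro linf_norm_le_imp_abs_le[of \<Omega> "\<lambda>w. Re (f w)"])
       (auto intro!: continuous_intros holomorphic_on_imp_continuous_on simp: one_ereal_def)
  have "(?d * (2 - ?d / ?R)) ^ n * cmod ((deriv ^^ n) f z) \<le> C_inf n"
    unfolding d using sub \<open>?d > 0\<close> d Re_f assms(3)
    by (intro disc_deriv_bound holomorphic_on_subset[OF assms(8)]) auto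
  moreover have "?d / ?R \<le> 1"
    using d \<open>?d > 0\<close> zero_le_dist[of \<zeta> z] by (intro divide_le_eq_1_pos[THEN iffD2]) linarith+
  then have "(2 - ?d / ?R) ^ n > 0"
    by (intro zero_less_power) linarith
  ultimately have "?d ^ n * cmod ((deriv ^^ n) f z) \<le> C_inf n / (2 - ?d / ?R) ^ n"
    by (simp add: pos_le_divide_eq power_mult_distrib mult_ac)
  then show ?thesis
    using C_inf_odd by auto
qed

end
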